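(* Let $\omega$ be a circle with center $O$ and $\xi$ an ellipse with center $O$ lying inside $\omega$. Let $(u_1,\dots,u_n)$ be a Poncelet $n$-gon for the pair $(\omega,\xi)$. Then $\prod_{i=1}^n\cos\angle u_{i-1}u_iu_{i+1}$ is constant in the Poncelet family of $n$-gons containing $(u_1,\dots,u_n)$.
   Context: Indices are mod $n$. A Poncelet $n$-gon for a pair of conics $(C,D)$, $D$ inside $C$, is a closed polygon with all vertices on $C$ and all sides tangent to $D$. By the Poncelet porism, if one such closed $n$-gon exists, then starting from any point of $C$ and successively drawing tangent lines to $D$ (in the same rotational sense) produces a closed $n$-gon; the Poncelet family is this continuous 1-parameter family. $\angle u_{i-1}u_iu_{i+1}\in[0,\pi]$ is the angle at $u_i$ between the segments $u_iu_{i-1}$ and $u_iu_{i+1}$. *)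

theory Defs
  imports "HOL-Analysis.Analysis"
begin

text \<open>Ellipse with centre c0, semi-axes a, b (both positive) along the directions
  e and i*e, where e is a unit complex number (arbitrary orientation).\<close>
definition ellipse :: "complex \<Rightarrow> real \<Rightarrow> real \<Rightarrow> complex \<Rightarrow> complex set" where
  "ellipse c0 a b e = {c0 + e * Complex (a * cos t) (b * sin t) | t. True}"

definition line_through :: "complex \<Rightarrow> complex \<Rightarrow> complex set" where
  "line_through p q = {p + of_real t * (q - p) | t. True}"

definition tangent_line :: "complex set \<Rightarrow> complex \<Rightarrow> complex \<Rightarrow> bool" where
  "tangent_line E p q \<longleftrightarrow> p \<noteq> q \<and> (\<exists>!z. z \<in> E \<and> z \<in> line_through p q)"

definition vertex_angle :: "complex \<Rightarrow> complex \<Rightarrow> complex \<Rightarrow> real" where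
  "vertex_angle a b c = arccos (((a - b) \<bullet> (c - b)) / (norm (a - b) * norm (c - b)))"

text \<open>Closed Poncelet n-gon for the circle (centre c0, radius R) and the conic E,
  indices taken mod n (u is n-periodic), every side traversed in the same
  rotational sense s about c0 (s = 1: counterclockwise, s = -1: clockwise).
  Drawing tangents successively in a fixed rotational sense is exactly this.\<close>
definition poncelet_polygon ::
  "complex \<Rightarrow> real \<Rightarrow> complex set \<Rightarrow> nat \<Rightarrow> real \<Rightarrow> (nat \<Rightarrow> complex) \<Rightarrow> bool" where
  "poncelet_polygon c0 R E n s u \<longleftrightarrow>
     (\<forall>i. u (i + n) = u i) \<and>
     (\<forall>i. dist (u i) c0 = R) \<and>
     (\<forall>i. tangent_line E (u i) (u (Suc i))) \<and>
     (\<forall>i. sgn (Im (cnj (u i - c0) * (u (Suc i) - c0))) = s)"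

end

theory Submission
  imports Defs
begin

text \<open>
  Normalise to the unit circle and let the ellipse have squared semi-axes \<open>\<alpha>\<close>, \<open>\<beta>\<close>. A chord with
  end angles \<open>x\<close>, \<open>y\<close> is tangent to the ellipse iff \<open>cos (y - x) = k cos (x + y) + m\<close>, where
  \<open>k = \<alpha> - \<beta>\<close> and \<open>m = \<alpha> + \<beta> - 1\<close>. With \<open>G x = 1 + k\<^sup>2 - 2 k cos 2x\<close> and \<open>q = sqrt (G - m\<^sup>2)\<close>, the
  measure \<open>dx / q\<close> is invariant under the Poncelet map, so in the parameter \<open>h = \<integral> dx / q\<close> this map is
  a translation. This gives the porism and makes the whole family a flow. The cosine of the angle
  at the vertex \<open>x\<close> is \<open>- m / sqrt (G x)\<close>, and the derivative of \<open>ln (G x)\<close> along the flow is \<open>2 f x\<close>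
  with \<open>f x + f y = l x - l y\<close> for every tangent chord, \<open>l = m (1 - k\<^sup>2) / G\<close>. Summing over the
  closed polygon, the derivative of the logarithm of the product vanishes.
\<close>

subsection \<open>The Poncelet map on angles\<close>

text \<open>The assumption on \<open>k = \<alpha> - \<beta>\<close> and \<open>m = \<alpha> + \<beta> - 1\<close> says exactly that \<open>\<alpha>\<close> and \<open>\<beta>\<close> lie in
  the open unit interval.\<close>

locale poncelet_parameters =
  fixes k m :: real
  assumes small: "\<bar>k\<bar> + \<bar>m\<bar> < 1"
begin

section \<open>Trigonometry of one tangent chord and of two consecutive ones\<close>

definition tangent_chord :: "real \<Rightarrow> real \<Rightarrow> bool" where
  "tangent_chord x y \<longleftrightarrow> 0 < y - x \<and> y - x < pi \<and> cos (y - x) = k * cos (x + y) + m"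

definition G :: "real \<Rightarrow> real" where
  "G x = 1 + k\<^sup>2 - 2 * k * cos (2 * x)"

definition q :: "real \<Rightarrow> real" where
  "q x = sqrt (G x - m\<^sup>2)"

lemma abs_m_less: "\<bar>m\<bar> < 1 - \<bar>k\<bar>"
  using small by linarith

lemma abs_cos_combination_less: "\<bar>k * cos x + m\<bar> < 1"
proof -
  have "\<bar>k * cos x\<bar> \<le> \<bar>k\<bar>"
    by (simp add: abs_mult mult_left_le)
  then show ?thesis using small by linarith
qed

text \<open>\<open>G x\<close> is the squared modulus of \<open>1 - k * cis (2 * x)\<close>, hence
  at least \<open>(1 - \<bar>k\<bar>)\<^sup>2\<close>. The strict bound keeps the radicand of
  \<open>q\<close> positive.\<close>

lemma G_gt: "m\<^sup>2 < G x"
proof -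
  have "\<bar>m\<bar>\<^sup>2 < (1 - \<bar>k\<bar>)\<^sup>2"
    by (rule power_strict_mono[OF abs_m_less]) auto
  moreover have "\<bar>k * cos (2 * x)\<bar> \<le> \<bar>k\<bar>"
    by (simp add: abs_mult mult_left_le)
  ultimately show ?thesis
    by (simp add: G_def power2_diff abs_le_iff)
qed

lemma G_pos: "0 < G x"
  using G_gt[of x] zero_le_power2[of m] by linarith

lemma q_pos: "0 < q x"
  using G_gt[of x] by (simp add: q_def)

lemma q_squared: "(q x)\<^sup>2 = G x - m\<^sup>2"
  using G_gt[of x] by (simp add: q_def)

text \<open>The right-hand sides are, up to sign, the partial derivatives of the chord equation in
  \<open>y\<close> and in \<open>x\<close>, so the endpoints of a moving chord have speeds in the
  ratio of \<open>q x\<close> to \<open>q y\<close>. The squares agree by addition formulas for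
  \<open>2 * x = S - D\<close> and \<open>2 * y = S + D\<close>.\<close>

lemma q_tangent_chord:
  assumes "tangent_chord x y"
  shows "q x = sin (y - x) - k * sin (x + y)" and "q y = sin (y - x) + k * sin (x + y)"
proof -
  define D S where "D = y - x" and "S = x + y"
  have D: "0 < sin D" and eq: "cos D = k * cos S + m"
    using assms by (auto simp: tangent_chord_def D_def S_def sin_gt_zero)
  have Gx: "G x = 1 + k\<^sup>2 - 2 * k * (cos S * cos D + sin S * sin D)"
    using cos_diff[of S D] by (simp add: G_def D_def S_def)
  have Gy: "G y = 1 + k\<^sup>2 - 2 * k * (cos S * cos D - sin S * sin D)"
    using cos_add[of S D] by (simp add: G_def D_def S_def)
  have tr: "(sin D)\<^sup>2 + (cos D)\<^sup>2 = 1" "(sin S)\<^sup>2 + (cos S)\<^sup>2 = 1" by simp_all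
  have sx: "(sin D - k * sin S)\<^sup>2 = (q x)\<^sup>2"
    unfolding q_squared Gx using tr eq by algebra
  have sy: "(sin D + k * sin S)\<^sup>2 = (q y)\<^sup>2"
    unfolding q_squared Gy using tr eq by algebra
  \<comment> \<open>Only the signs remain: \<open>(sin D)\<^sup>2 - (k * sin S)\<^sup>2\<close>
    equals \<open>1 - k\<^sup>2 - m\<^sup>2 - 2 * m * k * cos S\<close>, which is at least
    \<open>1 - (\<bar>k\<bar> + \<bar>m\<bar>)\<^sup>2 > 0\<close>.\<close>
  have "(k * sin S)\<^sup>2 < (sin D)\<^sup>2"
  proof -
    have "(k * sin S)\<^sup>2 = k\<^sup>2 + m\<^sup>2 + 2 * m * (k * cos S) - (cos D)\<^sup>2"
      using tr eq by algebra
    moreover have "m * (k * cos S) \<le> \<bar>k\<bar> * \<bar>m\<bar>"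
    proof -
      have "\<bar>k * cos S\<bar> \<le> \<bar>k\<bar>"
        by (simp add: abs_mult mult_left_le)
      then have "\<bar>m * (k * cos S)\<bar> \<le> \<bar>m\<bar> * \<bar>k\<bar>"
        unfolding abs_mult[of m] by (rule mult_left_mono) simp
      then show ?thesis by (simp add: abs_le_iff mult.commute)
    qed
    moreover have "k\<^sup>2 + m\<^sup>2 + 2 * (\<bar>k\<bar> * \<bar>m\<bar>) < 1"
      using power_strict_mono[OF small, of 2] by (simp add: power2_sum)
    ultimately show ?thesis
      unfolding sin_squared_eq[of D] by linarith
  qed
  then have "\<bar>k * sin S\<bar> < \<bar>sin D\<bar>"
    by (metis abs_le_square_iff linorder_not_le)
  then have "0 < sin D - k * sin S" "0 < sin D + k * sin S"
    using D by linarith+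
  then show "q x = sin (y - x) - k * sin (x + y)" "q y = sin (y - x) + k * sin (x + y)"
    using sx sy q_pos[of x] q_pos[of y]
    by (auto simp: D_def S_def power2_eq_iff_nonneg)
qed

definition f :: "real \<Rightarrow> real" where
  "f x = 2 * k * q x * sin (2 * x) / G x"

text \<open>With \<open>l = m * (1 - k\<^sup>2) / G\<close>, both \<open>l x - f x\<close> and
  \<open>l y + f y\<close> equal \<open>cos D + k * cos S\<close>, a quantity attached to the chord
  rather than to an endpoint.\<close>

lemma telescoping_tangent_chord:
  assumes "tangent_chord x y"
  shows "f x + f y = m * (1 - k\<^sup>2) / G x - m * (1 - k\<^sup>2) / G y"
proof -
  define D S where "D = y - x" and "S = x + y"
  have eq: "cos D = k * cos S + m"
    using assms by (auto simp: tangent_chord_def D_def S_def)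
  have q: "q x = sin D - k * sin S" "q y = sin D + k * sin S"
    using q_tangent_chord[OF assms] by (simp_all add: D_def S_def)
  have Gx: "G x = 1 + k\<^sup>2 - 2 * k * (cos S * cos D + sin S * sin D)"
    and sx: "sin (2 * x) = sin S * cos D - cos S * sin D"
    using cos_diff[of S D] sin_diff[of S D] by (simp_all add: G_def D_def S_def)
  have Gy: "G y = 1 + k\<^sup>2 - 2 * k * (cos S * cos D - sin S * sin D)"
    and sy: "sin (2 * y) = sin S * cos D + cos S * sin D"
    using cos_add[of S D] sin_add[of S D] by (simp_all add: G_def D_def S_def)
  have tr: "(sin D)\<^sup>2 + (cos D)\<^sup>2 = 1" "(sin S)\<^sup>2 + (cos S)\<^sup>2 = 1" by simp_all
  have "G x * (cos D + k * cos S) = m * (1 - k\<^sup>2) - 2 * k * q x * sin (2 * x)"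
    unfolding Gx sx q using tr eq by algebra
  then have 1: "cos D + k * cos S = m * (1 - k\<^sup>2) / G x - f x"
    using G_pos[of x]
    by (simp add: f_def diff_divide_distrib[symmetric] eq_divide_eq mult.commute)
  have "G y * (cos D + k * cos S) = m * (1 - k\<^sup>2) + 2 * k * q y * sin (2 * y)"
    unfolding Gy sy q using tr eq by algebra
  then have 2: "cos D + k * cos S = m * (1 - k\<^sup>2) / G y + f y"
    using G_pos[of y]
    by (simp add: f_def add_divide_distrib[symmetric] eq_divide_eq mult.commute)
  show ?thesis using 1 2 by linarith
qed

text \<open>By the inscribed angle theorem the angle at \<open>y\<close> is \<open>pi - (z - x) / 2\<close>. The vertices \<open>x\<close>, \<open>z\<close> are
  the two intersections of the circle with the line of all \<open>w\<close> with inner product \<open>m\<close> with the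
  vector \<open>(P, Q)\<close> of squared length \<open>G y\<close>.\<close>

lemma cos_half_vertex:
  assumes "tangent_chord x y" and "tangent_chord y z"
  shows "cos ((z - x) / 2) = m / sqrt (G y)"
proof -
  define P Q where "P = (1 - k) * cos y" and "Q = (1 + k) * sin y"
  define t where "t = (z - x) / 2"
  have t2: "2 * t = z - x" by (simp add: t_def)
  have tr: "(sin x)\<^sup>2 + (cos x)\<^sup>2 = 1" "(sin y)\<^sup>2 + (cos y)\<^sup>2 = 1" "(sin z)\<^sup>2 + (cos z)\<^sup>2 = 1"
    by simp_all
  have G: "G y = P\<^sup>2 + Q\<^sup>2"
    unfolding G_def P_def Q_def cos_double using tr by algebra
  have z1: "P * cos z + Q * sin z = m"
    using assms(2) by (simp add: tangent_chord_def cos_diff cos_add P_def Q_def algebra_simps)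
  have z2: "P * sin z - Q * cos z = q y"
    using q_tangent_chord(1)[OF assms(2)] by (simp add: sin_diff sin_add P_def Q_def algebra_simps)
  have x1: "P * cos x + Q * sin x = m"
    using assms(1) by (simp add: tangent_chord_def cos_diff cos_add P_def Q_def algebra_simps)
  have x2: "P * sin x - Q * cos x = - q y"
    using q_tangent_chord(2)[OF assms(1)] by (simp add: sin_diff sin_add P_def Q_def algebra_simps)
  have c: "G y * cos (2 * t) = m\<^sup>2 - (q y)\<^sup>2"
  proof -
    have "cos (2 * t) = cos z * cos x + sin z * sin x"
      using cos_diff[of z x] unfolding t2 .
    then show ?thesis unfolding G using x1 x2 z1 z2 by algebra
  qed
  have s: "G y * sin (2 * t) = 2 * m * q y"
  proof -
    have "sin (2 * t) = sin z * cos x - cos z * sin x"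
      using sin_diff[of z x] unfolding t2 .
    then show ?thesis unfolding G using x1 x2 z1 z2 by algebra
  qed
  have t: "0 < sin t"
    using assms by (intro sin_gt_zero) (auto simp: tangent_chord_def t_def)
  have sq: "(sqrt (G y))\<^sup>2 = G y" "0 < sqrt (G y)" using G_pos[of y] by simp_all
  \<comment> \<open>The value of \<open>cos (2 * t)\<close> fixes \<open>cos t\<close> up to sign.
    Since \<open>sin t\<close> and \<open>q y\<close> are positive, \<open>s\<close> excludes the
    wrong sign unless \<open>m = 0\<close>, where both signs agree.\<close>
  have "(sqrt (G y) * cos t)\<^sup>2 = m\<^sup>2"
    using c sq(1) q_squared[of y] unfolding cos_double_cos by algebra
  then consider "sqrt (G y) * cos t = m" | "sqrt (G y) * cos t = - m"
    by (auto simp: power2_eq_iff)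
  then have "sqrt (G y) * cos t = m"
  proof cases
    case 2
    have "m * (sqrt (G y) * sin t + q y) = 0"
      using s 2 sq(1) unfolding sin_double by algebra
    moreover have "0 < sqrt (G y) * sin t + q y"
      using t sq(2) q_pos[of y] by (simp add: add_pos_pos)
    ultimately have "m = 0" by simp
    then show ?thesis using 2 by simp
  qed
  then show ?thesis
    using sq(2) by (simp add: t_def field_simps)
qed

section \<open>The invariant measure and the coordinate that turns the Poncelet map into a
  translation\<close>

lemma continuous_q: "isCont (\<lambda>x. 1 / q x) x"
  using q_pos[of x] unfolding q_def G_def by (intro continuous_intros) auto

text \<open>In general an elliptic integral, so some antiderivative is chosen; the additive constant
  is immaterial.\<close>

definition h :: "real \<Rightarrow> real" where
  "h = (SOME h. \<forall>x. (h has_real_derivative 1 / q x) (at x))"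

lemma DERIV_h: "(h has_real_derivative 1 / q x) (at x)"
proof -
  have "\<exists>F. \<forall>x::real. -\<infinity> < ereal x \<longrightarrow> ereal x < \<infinity> \<longrightarrow> (F has_vector_derivative 1 / q x) (at x)"
    by (rule einterval_antiderivative) (auto intro: continuous_q)
  then have "\<exists>F. \<forall>x. (F has_real_derivative 1 / q x) (at x)"
    by (simp add: has_real_derivative_iff_has_vector_derivative)
  then have "\<forall>x. (h has_real_derivative 1 / q x) (at x)"
    unfolding h_def by (rule someI_ex)
  then show ?thesis ..
qed

lemma q_le: "q x \<le> 2"
proof -
  have "\<bar>k * cos (2 * x)\<bar> \<le> \<bar>k\<bar>"
    by (simp add: abs_mult mult_left_le)
  moreover have "k\<^sup>2 \<le> 1"
    using small by (simp add: abs_square_le_1)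
  moreover have "\<bar>k\<bar> < 1" using small by linarith
  ultimately have "G x - m\<^sup>2 \<le> 2\<^sup>2"
    using zero_le_power2[of m] unfolding G_def power2_eq_square[of 2] by linarith
  then show ?thesis
    unfolding q_def using real_le_lsqrt[of 2] by simp
qed

text \<open>Since \<open>q\<close> is at most 2, \<open>h\<close> has slope at least 1/2. This
  yields injectivity and, through unboundedness in both directions, surjectivity.\<close>

lemma h_expanding:
  assumes "x \<le> y"
  shows "(y - x) / 2 \<le> h y - h x"
proof -
  have "h x - x / 2 \<le> h y - y / 2"
  proof (rule DERIV_nonneg_imp_nondecreasing[OF assms])
    fix z
    have "((\<lambda>z. h z - z / 2) has_real_derivative 1 / q z - 1 / 2) (at z)"
      by (auto intro!: derivative_eq_intros DERIV_h)
    moreover have "0 \<le> 1 / q z - 1 / 2"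
      using q_le[of z] q_pos[of z] by (simp add: field_simps)
    ultimately show "\<exists>l. ((\<lambda>z. h z - z / 2) has_real_derivative l) (at z) \<and> 0 \<le> l"
      by blast
  qed
  then show ?thesis by (simp add: field_simps)
qed

lemma bij_h: "bij h"
proof (rule bijI)
  show "inj h"
  proof (rule linorder_injI)
    fix x y :: real assume "x < y"
    then show "h x \<noteq> h y" using h_expanding[of x y] by simp
  qed
  show "surj h"
    unfolding surj_def
  proof
    fix t
    define r where "r = 2 * \<bar>t - h 0\<bar>"
    have "\<exists>x. - r \<le> x \<and> x \<le> r \<and> h x = t"
    proof (rule IVT)
      show "h (- r) \<le> t" using h_expanding[of "- r" 0] by (simp add: r_def)
      show "t \<le> h r" using h_expanding[of 0 r] by (simp add: r_def)
      show "- r \<le> r" by (simp add: r_def)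
      show "\<forall>x. - r \<le> x \<and> x \<le> r \<longrightarrow> isCont h x"
        using DERIV_h DERIV_isCont by blast
    qed
    then show "\<exists>x. t = h x" by blast
  qed
qed

definition \<Theta> :: "real \<Rightarrow> real" where
  "\<Theta> = inv h"

lemma h_\<Theta>: "h (\<Theta> t) = t"
  using bij_h by (simp add: \<Theta>_def bij_is_surj surj_f_inv_f)

lemma \<Theta>_h: "\<Theta> (h x) = x"
  using bij_h by (simp add: \<Theta>_def bij_is_inj)

lemma DERIV_\<Theta>: "(\<Theta> has_real_derivative q (\<Theta> t)) (at t)"
proof -
  have "isCont \<Theta> (h (\<Theta> t))"
    by (rule isCont_inverse_function[where d = 1]) (auto simp: \<Theta>_h intro: DERIV_isCont DERIV_h)
  then have "isCont \<Theta> t" by (simp add: h_\<Theta>)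
  then have "(\<Theta> has_real_derivative inverse (1 / q (\<Theta> t))) (at t)"
    using q_pos[of "\<Theta> t"]
    by (intro DERIV_inverse_function[where a = "t - 1" and b = "t + 1", OF DERIV_h])
      (auto simp: h_\<Theta>)
  then show ?thesis by simp
qed

text \<open>By periodicity of \<open>q\<close> the difference has derivative 0. A number of full
  turns thus costs the same amount of \<open>h\<close> from every starting point, which carries the
  closing of one orbit over to all others.\<close>

lemma h_translate: "h (x + 2 * pi * of_int j) - h x = h (y + 2 * pi * of_int j) - h y"
proof -
  have "\<forall>x. ((\<lambda>x. h (x + 2 * pi * of_int j) - h x) has_real_derivative 0) (at x)"
  proof
    fix x
    have "q (x + 2 * pi * of_int j) = q x"
      using cos.plus_of_int[of "2 * x" "2 * j"] by (simp add: q_def G_def algebra_simps)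
    then show "((\<lambda>x. h (x + 2 * pi * of_int j) - h x) has_real_derivative 0) (at x)"
      by (auto intro!: derivative_eq_intros DERIV_chain2[OF DERIV_h])
  qed
  then show ?thesis by (rule DERIV_isconst_all)
qed

text \<open>Tangent chords are parametrised by the direction \<open>x\<close> of their normal: the end angles are
  \<open>x - d x\<close> and \<open>x + d x\<close>.\<close>

definition d :: "real \<Rightarrow> real" where
  "d x = arccos (k * cos (2 * x) + m) / 2"

lemma cos_2d: "cos (2 * d x) = k * cos (2 * x) + m"
  using abs_cos_combination_less[of "2 * x"] by (simp add: d_def cos_arccos_abs)

lemma d_bounds: "0 < d x" "d x < pi / 2"
  using arccos_lt_bounded[of "k * cos (2 * x) + m"] abs_cos_combination_less[of "2 * x"]
  by (auto simp: d_def abs_less_iff)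

lemma tangent_chord_d: "tangent_chord (x - d x) (x + d x)"
  using d_bounds[of x] cos_2d[of x] by (simp add: tangent_chord_def)

lemma tangent_chord_imp_d:
  assumes "tangent_chord x y"
  shows "x = (x + y) / 2 - d ((x + y) / 2)" "y = (x + y) / 2 + d ((x + y) / 2)"
proof -
  define c where "c = (x + y) / 2"
  have "2 * c = x + y" by (simp add: c_def)
  then have "2 * d c = arccos (cos (y - x))"
    using assms by (simp add: d_def tangent_chord_def)
  also have "\<dots> = y - x"
    using assms by (intro arccos_cos) (auto simp: tangent_chord_def)
  finally have "2 * d c = y - x" .
  then show "x = (x + y) / 2 - d ((x + y) / 2)" "y = (x + y) / 2 + d ((x + y) / 2)"
    unfolding c_def[symmetric] by (simp_all add: c_def field_simps)
qed

lemma DERIV_d: "(d has_real_derivative k * sin (2 * x) / sin (2 * d x)) (at x)"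
proof -
  define w where "w = k * cos (2 * x) + m"
  have w: "- 1 < w" "w < 1"
    using abs_cos_combination_less[of "2 * x"] by (auto simp: w_def abs_less_iff)
  have s: "sin (2 * d x) = sqrt (1 - w\<^sup>2)"
    using w by (simp add: d_def w_def sin_arccos)
  have "((\<lambda>x. k * cos (2 * x) + m) has_real_derivative - 2 * k * sin (2 * x)) (at x)"
    by (auto intro!: derivative_eq_intros)
  then have "((\<lambda>x. arccos (k * cos (2 * x) + m)) has_real_derivative
      inverse (- sqrt (1 - w\<^sup>2)) * (- 2 * k * sin (2 * x))) (at x)"
    using DERIV_chain2[where f = arccos and g = "\<lambda>x. k * cos (2 * x) + m" and x = x] DERIV_arccos[OF w]
    unfolding w_def by blast
  from DERIV_cdivide[OF this, of 2]
  have "(d has_real_derivative inverse (- sin (2 * d x)) * (- 2 * k * sin (2 * x)) / 2) (at x)"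
    unfolding s by (simp only: d_def[abs_def])
  \<comment> \<open>For \<open>u = 0\<close> both sides are 0 by the convention for division, so the
    rewriting is unconditional.\<close>
  moreover have "inverse (- u) * (- 2 * k * v) / 2 = k * v / u" for u v :: real
    by (cases "u = 0") (simp_all add: field_simps)
  ultimately show ?thesis by (simp only:)
qed

text \<open>Invariance of the measure: by \<open>q_tangent_chord\<close> the endpoints move with
  speeds \<open>q (x + d x) / s\<close> and \<open>q (x - d x) / s\<close>, so after multiplication
  by \<open>1 / q\<close> both have speed \<open>1 / s\<close> in the coordinate
  \<open>h\<close>.\<close>

lemma h_tangent_chord_const: "h (x + d x) - h (x - d x) = h (y + d y) - h (y - d y)"
proof -
  have "\<forall>x. ((\<lambda>x. h (x + d x) - h (x - d x)) has_real_derivative 0) (at x)"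
  proof
    fix x
    define s where "s = sin (2 * d x)"
    have s: "0 < s"
      unfolding s_def using d_bounds[of x] by (intro sin_gt_zero) auto
    have q: "q (x - d x) = s - k * sin (2 * x)" "q (x + d x) = s + k * sin (2 * x)"
      using q_tangent_chord[OF tangent_chord_d[of x]] by (simp_all add: s_def)
    have "((\<lambda>x. h (x + d x) - h (x - d x)) has_real_derivative
        1 / q (x + d x) * (1 + k * sin (2 * x) / s) - 1 / q (x - d x) * (1 - k * sin (2 * x) / s)) (at x)"
      unfolding s_def
      by (intro DERIV_diff DERIV_chain2[OF DERIV_h] DERIV_add DERIV_ident DERIV_d)
    moreover have "1 + k * sin (2 * x) / s = q (x + d x) / s" "1 - k * sin (2 * x) / s = q (x - d x) / s"
      using s by (simp_all add: q field_simps)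
    ultimately show "((\<lambda>x. h (x + d x) - h (x - d x)) has_real_derivative 0) (at x)"
      using q_pos[of "x + d x"] q_pos[of "x - d x"] by simp
  qed
  then show ?thesis by (rule DERIV_isconst_all)
qed

text \<open>The translation length of the Poncelet map. The base direction 0 is arbitrary by the
  preceding lemma and is left unsimplified to match its instance.\<close>

definition \<kappa> :: real where
  "\<kappa> = h (0 + d 0) - h (0 - d 0)"

lemma h_tangent_chord:
  assumes "tangent_chord x y"
  shows "h y = h x + \<kappa>"
proof -
  define c where "c = (x + y) / 2"
  have "x = c - d c" "y = c + d c"
    using tangent_chord_imp_d[OF assms] unfolding c_def .
  then have "h y - h x = \<kappa>"
    using h_tangent_chord_const[of c 0] by (simp only: \<kappa>_def)
  then show ?thesis by simp
qed

text \<open>As \<open>d\<close> lies between 0 and \<open>pi / 2\<close>, the intermediate value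
  theorem gives a chord starting at any prescribed angle; its other end is then forced by
  \<open>h_tangent_chord\<close>.\<close>

lemma tangent_chord_\<Theta>: "tangent_chord (\<Theta> t) (\<Theta> (t + \<kappa>))"
proof -
  define x where "x = \<Theta> t"
  have "\<exists>z. x \<le> z \<and> z \<le> x + pi \<and> z - d z = x"
  proof (rule IVT)
    show "x - d x \<le> x" "x \<le> x + pi - d (x + pi)" "x \<le> x + pi"
      using d_bounds[of x] d_bounds[of "x + pi"] by auto
    show "\<forall>z. x \<le> z \<and> z \<le> x + pi \<longrightarrow> isCont (\<lambda>z. z - d z) z"
      using DERIV_isCont[OF DERIV_d] by (auto intro!: continuous_intros)
  qed
  then obtain z where z: "z - d z = x" by blast
  have e: "tangent_chord x (z + d z)" using tangent_chord_d[of z] by (simp add: z)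
  have "z + d z = \<Theta> (t + \<kappa>)"
    using h_tangent_chord[OF e] \<Theta>_h[of "z + d z"] by (simp add: x_def h_\<Theta>)
  then show ?thesis using e by (simp add: x_def)
qed

section \<open>Constancy of the product along the flow, and the porism\<close>

lemma prod_G_const:
  assumes periodic: "\<And>t. \<exists>j::int. \<Theta> (t + real n * \<kappa>) = \<Theta> t + 2 * pi * of_int j"
  shows "(\<Prod>i<n. G (\<Theta> (t + real i * \<kappa>))) = (\<Prod>i<n. G (\<Theta> (t' + real i * \<kappa>)))"
proof -
  define Q where "Q t = (\<Sum>i<n. ln (G (\<Theta> (t + real i * \<kappa>))))" for t
  have "\<forall>t. (Q has_real_derivative 0) (at t)"
  proof
    fix t
    define F where "F i = f (\<Theta> (t + real i * \<kappa>))" for i :: nat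
    define L where "L i = m * (1 - k\<^sup>2) / G (\<Theta> (t + real i * \<kappa>))" for i :: nat
    obtain j :: int where j: "\<Theta> (t + real n * \<kappa>) = \<Theta> t + 2 * pi * of_int j"
      using periodic by blast
    have G: "G (\<Theta> t + 2 * pi * of_int j) = G (\<Theta> t)"
      using cos.plus_of_int[of "2 * \<Theta> t" "2 * j"] by (simp add: G_def algebra_simps)
    have "sin (2 * (\<Theta> t + 2 * pi * of_int j)) = sin (2 * \<Theta> t)"
      using sin.plus_of_int[of "2 * \<Theta> t" "2 * j"] by (simp add: algebra_simps)
    then have FL: "F n = F 0" "L n = L 0"
      by (simp_all add: F_def L_def j G f_def q_def)
    have step: "F i + F (Suc i) = L i - L (Suc i)" for i
      using telescoping_tangent_chord[OF tangent_chord_\<Theta>[of "t + real i * \<kappa>"]]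
      by (simp add: F_def L_def algebra_simps)
    \<comment> \<open>This sum telescopes to \<open>L 0 - L n\<close>. By periodicity it is also
      twice the sum of the \<open>F i\<close>, which therefore vanishes.\<close>
    have "(\<Sum>i<n. F i + F (Suc i)) = 0"
      unfolding step sum_lessThan_telescope' by (simp add: FL)
    moreover have "(\<Sum>i<n. F (Suc i)) - (\<Sum>i<n. F i) = 0"
      unfolding sum_subtractf[symmetric] sum_lessThan_telescope by (simp add: FL)
    ultimately have F: "(\<Sum>i<n. F i) = 0"
      by (simp add: sum.distrib)
    have "(Q has_real_derivative (\<Sum>i<n. 2 * F i)) (at t)"
      unfolding Q_def
    proof (rule DERIV_sum)
      fix i
      define x where "x = \<Theta> (t + real i * \<kappa>)"
      have 1: "((\<lambda>t. \<Theta> (t + real i * \<kappa>)) has_real_derivative q x * 1) (at t)"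
        unfolding x_def by (rule DERIV_chain2[OF DERIV_\<Theta>]) (auto intro!: derivative_eq_intros)
      have 2: "((\<lambda>x. ln (G x)) has_real_derivative 4 * k * sin (2 * x) / G x) (at x)"
        using G_pos[of x] unfolding G_def by (auto intro!: derivative_eq_intros)
      show "((\<lambda>t. ln (G (\<Theta> (t + real i * \<kappa>)))) has_real_derivative 2 * F i) (at t)"
        using DERIV_chain2[OF 2[unfolded x_def] 1]
        by (simp add: F_def f_def x_def mult_ac)
    qed
    then show "(Q has_real_derivative 0) (at t)"
      by (simp add: sum_distrib_left[symmetric] F)
  qed
  then have "Q t = Q t'" by (rule DERIV_isconst_all)
  then have "ln (\<Prod>i<n. G (\<Theta> (t + real i * \<kappa>))) = ln (\<Prod>i<n. G (\<Theta> (t' + real i * \<kappa>)))"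
    using G_pos by (simp add: Q_def ln_prod less_imp_neq[THEN not_sym])
  then show ?thesis
    using G_pos by (simp add: prod_pos)
qed

text \<open>Closing of \<open>x\<close> says that \<open>real n * \<kappa>\<close> is the
  \<open>h\<close>-length of \<open>j\<close> full turns. By \<open>h_translate\<close> every orbit
  then closes after \<open>n\<close> steps, so \<open>prod_G_const\<close> compares the orbits of
  \<open>x\<close> and \<open>y\<close>.\<close>

lemma prod_cos_half_vertex_const:
  fixes x y :: "nat \<Rightarrow> real"
  assumes "\<And>i. tangent_chord (x i) (x (Suc i))" and "\<And>i. tangent_chord (y i) (y (Suc i))"
    and closed: "x n = x 0 + 2 * pi * of_int j"
  shows "(\<Prod>i<n. cos ((x (Suc (Suc i)) - x i) / 2)) = (\<Prod>i<n. cos ((y (Suc (Suc i)) - y i) / 2))"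
proof -
  have sqrt_prod: "sqrt (prod g {..<n}) = (\<Prod>i<n. sqrt (g i))" for g :: "nat \<Rightarrow> real" and n
    by (induction n) (simp_all add: real_sqrt_mult)
  have orbit: "z i = \<Theta> (h (z 0) + real i * \<kappa>)" if "\<And>i. tangent_chord (z i) (z (Suc i))" for z :: "nat \<Rightarrow> real" and i
  proof -
    have "h (z i) = h (z 0) + real i * \<kappa>"
    proof (induction i)
      case (Suc i)
      then show ?case using h_tangent_chord[OF that, of i] by (simp add: distrib_right)
    qed simp
    then show ?thesis using \<Theta>_h[of "z i"] by metis
  qed
  have "h (x n) = h (x 0) + real n * \<kappa>"
    by (subst orbit[of x, OF assms(1)]) (rule h_\<Theta>)
  then have "h (\<Theta> t + 2 * pi * of_int j) = t + real n * \<kappa>" for t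
    using h_translate[of "\<Theta> t" j "x 0"] unfolding h_\<Theta> closed by linarith
  then have periodic: "\<exists>j::int. \<Theta> (t + real n * \<kappa>) = \<Theta> t + 2 * pi * of_int j" for t
    by (metis \<Theta>_h)
  have prod: "(\<Prod>i<n. cos ((z (Suc (Suc i)) - z i) / 2)) =
      m ^ n / sqrt (\<Prod>i<n. G (\<Theta> ((h (z 0) + \<kappa>) + real i * \<kappa>)))"
    if "\<And>i. tangent_chord (z i) (z (Suc i))" for z
  proof -
    \<comment> \<open>The apex of this angle is \<open>z (Suc i)\<close>, hence the extra
      \<open>\<kappa>\<close> in the starting parameter.\<close>
    have "cos ((z (Suc (Suc i)) - z i) / 2) = m / sqrt (G (\<Theta> ((h (z 0) + \<kappa>) + real i * \<kappa>)))" for i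
      using cos_half_vertex[OF that[of i] that[of "Suc i"]] 
      unfolding orbit[of z, OF that, of "Suc i"] by (simp add: algebra_simps)
    then show ?thesis
      by (simp add: prod_dividef sqrt_prod)
  qed
  show ?thesis
    unfolding prod[of x, OF assms(1)] prod[of y, OF assms(2)]
    using prod_G_const[OF periodic, of "h (x 0) + \<kappa>" "h (y 0) + \<kappa>"] by simp
qed

end
subsection \<open>Tangent chords of a circle\<close>

text \<open>The roots sum to \<open>- 2 * q / p\<close>, so \<open>- 2 * q / p - t\<close> is a root
  along with \<open>t\<close>, and uniqueness makes them coincide.\<close>

lemma unique_root_imp_discriminant_zero:
  fixes p q r :: real
  assumes "p \<noteq> 0" and "\<exists>!t. p * t\<^sup>2 + 2 * q * t + r = 0"
  shows "q\<^sup>2 = p * r"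
proof -
  obtain t where t: "p * t\<^sup>2 + 2 * q * t + r = 0"
    and uniq: "\<And>t'. p * t'\<^sup>2 + 2 * q * t' + r = 0 \<Longrightarrow> t' = t"
    using assms(2) by blast
  have "p * (- 2 * q / p - t)\<^sup>2 + 2 * q * (- 2 * q / p - t) + r = p * t\<^sup>2 + 2 * q * t + r"
    using assms(1) by (simp add: power2_eq_square field_simps)
  then have "- 2 * q / p - t = t"
    unfolding t by (rule uniq)
  then have "q = - p * t"
    using assms(1) by (simp add: field_simps)
  then show ?thesis using t by algebra
qed

lemma in_ellipse_iff:
  assumes "a > 0" and "b > 0" and "e \<noteq> 0"
  shows "c0 + e * z \<in> ellipse c0 a b e \<longleftrightarrow> (Re z)\<^sup>2 / a\<^sup>2 + (Im z)\<^sup>2 / b\<^sup>2 = 1"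
proof
  assume "c0 + e * z \<in> ellipse c0 a b e"
  then obtain t where "z = Complex (a * cos t) (b * sin t)"
    using assms(3) by (auto simp: ellipse_def)
  then show "(Re z)\<^sup>2 / a\<^sup>2 + (Im z)\<^sup>2 / b\<^sup>2 = 1"
    using assms by (simp add: power_mult_distrib)
next
  assume "(Re z)\<^sup>2 / a\<^sup>2 + (Im z)\<^sup>2 / b\<^sup>2 = 1"
  then have "(Re z / a)\<^sup>2 + (Im z / b)\<^sup>2 = 1"
    by (simp add: power_divide)
  then obtain t where "Re z / a = cos t" "Im z / b = sin t"
    by (rule sincos_total_2pi)
  then have "z = Complex (a * cos t) (b * sin t)"
    using assms by (auto simp: complex_eq_iff field_simps)
  then show "c0 + e * z \<in> ellipse c0 a b e"
    by (auto simp: ellipse_def)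
qed

text \<open>The dual equation of the ellipse, obtained as the vanishing discriminant of its equation
  restricted to the line.\<close>

lemma tangent_line_ellipse:
  assumes "a > 0" and "b > 0" and "e \<noteq> 0"
    and tan: "tangent_line (ellipse c0 a b e) (c0 + e * z) (c0 + e * w)"
  shows "(Re z * Im w - Im z * Re w)\<^sup>2 = b\<^sup>2 * (Re w - Re z)\<^sup>2 + a\<^sup>2 * (Im w - Im z)\<^sup>2"
proof -
  define X Y where "X = Re w - Re z" and "Y = Im w - Im z"
  define p q r where "p = b\<^sup>2 * X\<^sup>2 + a\<^sup>2 * Y\<^sup>2" and "q = b\<^sup>2 * Re z * X + a\<^sup>2 * Im z * Y"
    and "r = b\<^sup>2 * (Re z)\<^sup>2 + a\<^sup>2 * (Im z)\<^sup>2 - a\<^sup>2 * b\<^sup>2"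
  define \<gamma> where "\<gamma> t = c0 + e * (z + of_real t * (w - z))" for t :: real
  have "z \<noteq> w" using tan by (auto simp: tangent_line_def)
  then have XY: "X \<noteq> 0 \<or> Y \<noteq> 0" by (auto simp: X_def Y_def complex_eq_iff)
  have inj: "inj \<gamma>" using \<open>z \<noteq> w\<close> assms(3) by (auto simp: inj_def \<gamma>_def)
  have line: "line_through (c0 + e * z) (c0 + e * w) = range \<gamma>"
    by (auto simp: line_through_def \<gamma>_def algebra_simps)
  have mem: "\<gamma> t \<in> ellipse c0 a b e \<longleftrightarrow> p * t\<^sup>2 + 2 * q * t + r = 0" for t
  proof -
    have "(Re z + t * X)\<^sup>2 / a\<^sup>2 + (Im z + t * Y)\<^sup>2 / b\<^sup>2 - 1 = (p * t\<^sup>2 + 2 * q * t + r) / (a\<^sup>2 * b\<^sup>2)"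
      using assms(1,2) by (simp add: p_def q_def r_def power2_eq_square field_simps)
    then show ?thesis
      using assms(1,2) unfolding \<gamma>_def in_ellipse_iff[OF assms(1-3)]
      by (auto simp: X_def Y_def)
  qed
  have "p \<noteq> 0"
    using XY assms(1,2) by (auto simp: p_def add_nonneg_eq_0_iff)
  moreover have "\<exists>!t. p * t\<^sup>2 + 2 * q * t + r = 0"
    using tan inj unfolding tangent_line_def line mem[symmetric] inj_def by blast
  ultimately have "q\<^sup>2 = p * r"
    by (rule unique_root_imp_discriminant_zero)
  \<comment> \<open>Lagrange's identity for
    \<open>p * (r + a\<^sup>2 * b\<^sup>2) - q\<^sup>2\<close>.\<close>
  then have "a\<^sup>2 * b\<^sup>2 * (Re z * Y - Im z * X)\<^sup>2 = a\<^sup>2 * b\<^sup>2 * p"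
    unfolding p_def q_def r_def by algebra
  then have "(Re z * Y - Im z * X)\<^sup>2 = p"
    using assms(1,2) by simp
  moreover have "Re z * Y - Im z * X = Re z * Im w - Im z * Re w"
    by (simp add: X_def Y_def algebra_simps)
  ultimately show ?thesis by (simp add: p_def X_def Y_def)
qed

text \<open>The chord has normal direction \<open>S\<close> and distance
  \<open>R * \<bar>cos D\<bar>\<close> from the centre; equating this with the support function of
  the ellipse and doubling angles gives the formula. The condition on the sine allows cancelling
  \<open>(2 * R * sin D)\<^sup>2\<close>.\<close>

lemma tangent_chord_angles:
  fixes R a b x y :: real
  assumes "a > 0" and "b > 0" and "e \<noteq> 0" and "R > 0" and "sin (y - x) \<noteq> 0"
    and tan: "tangent_line (ellipse c0 a b e) (c0 + e * (of_real R * cis x)) (c0 + e * (of_real R * cis y))"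
  shows "cos (y - x) = (a\<^sup>2 - b\<^sup>2) / R\<^sup>2 * cos (x + y) + ((a\<^sup>2 + b\<^sup>2) / R\<^sup>2 - 1)"
proof -
  define D S where "D = (y - x) / 2" and "S = (x + y) / 2"
  have xy: "x = S - D" "y = S + D" by (simp_all add: D_def S_def field_simps)
  have D2: "y - x = 2 * D" and S2: "x + y = 2 * S" by (simp_all add: D_def S_def)
  have sD: "sin D \<noteq> 0" using assms(5) unfolding D2 sin_double by auto
  have "(R * cos x * (R * sin y) - R * sin x * (R * cos y))\<^sup>2 =
      b\<^sup>2 * (R * cos y - R * cos x)\<^sup>2 + a\<^sup>2 * (R * sin y - R * sin x)\<^sup>2"
    using tangent_line_ellipse[OF assms(1-3) tan] by simp
  moreover have "R * cos x * (R * sin y) - R * sin x * (R * cos y) = R\<^sup>2 * (2 * sin D * cos D)"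
    using sin_diff[of y x] unfolding D2 sin_double by algebra
  moreover have "R * cos y - R * cos x = - 2 * R * sin S * sin D"
    by (simp add: xy cos_add cos_diff algebra_simps)
  moreover have "R * sin y - R * sin x = 2 * R * cos S * sin D"
    by (simp add: xy sin_add sin_diff algebra_simps)
  ultimately have "(2 * R * sin D)\<^sup>2 * (R * cos D)\<^sup>2 =
      (2 * R * sin D)\<^sup>2 * (b\<^sup>2 * (sin S)\<^sup>2 + a\<^sup>2 * (cos S)\<^sup>2)"
    by algebra
  then have "(R * cos D)\<^sup>2 = b\<^sup>2 * (sin S)\<^sup>2 + a\<^sup>2 * (cos S)\<^sup>2"
    using sD assms(4) by simp
  then have "R\<^sup>2 * cos (2 * D) = (a\<^sup>2 - b\<^sup>2) * cos (2 * S) + (a\<^sup>2 + b\<^sup>2 - R\<^sup>2)"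
    unfolding cos_double_cos sin_squared_eq by algebra
  then have "cos (2 * D) = ((a\<^sup>2 - b\<^sup>2) * cos (2 * S) + (a\<^sup>2 + b\<^sup>2 - R\<^sup>2)) / R\<^sup>2"
    using assms(4) by (simp add: eq_divide_eq mult.commute)
  then show ?thesis
    using assms(4) unfolding D2 S2 by (simp add: add_divide_distrib diff_divide_distrib left_diff_distrib)
qed

section \<open>Vertex angles of a polygon inscribed in a circle\<close>

lemma cos_vertex_angle_circle:
  fixes R x y z :: real
  assumes "R > 0" and "cmod e = 1" and "s = 1 \<or> s = -1"
    and "0 < y - x" "y - x < 2 * pi" and "0 < z - y" "z - y < 2 * pi"
  shows "cos (vertex_angle (c0 + e * (of_real R * cis (s * x))) (c0 + e * (of_real R * cis (s * y)))
      (c0 + e * (of_real R * cis (s * z)))) = - cos ((z - x) / 2)"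
proof -
  have chord: "cis (s * u) - cis (s * v) = of_real (2 * s * sin ((u - v) / 2)) * (\<i> * cis (s * ((u + v) / 2)))" for u v
  proof -
    define D S where "D = (u - v) / 2" and "S = (u + v) / 2"
    have uv: "u = S + D" "v = S - D" by (simp_all add: D_def S_def field_simps)
    show ?thesis
      using assms(3) unfolding D_def[symmetric] S_def[symmetric] uv
      by (auto simp: complex_eq_iff cos_add cos_diff sin_add sin_diff)
  qed
  define p q where "p = sin ((y - x) / 2)" and "q = sin ((z - y) / 2)"
  have pq: "p > 0" "q > 0"
    using assms by (auto simp: p_def q_def intro!: sin_gt_zero)
  \<comment> \<open>Unit directions of the two sides, half the arc from \<open>x\<close> to
    \<open>z\<close> apart. The sides leave the vertex along \<open>- s\<close> times
    \<open>P\<close> and \<open>s\<close> times \<open>Q\<close>, whence the minus sign in the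
    result.\<close>
  define P Q where "P = \<i> * e * cis (s * ((x + y) / 2))" and "Q = \<i> * e * cis (s * ((z + y) / 2))"
  have PQ: "cmod P = 1" "cmod Q = 1"
    using assms(2) by (simp_all add: P_def Q_def norm_mult)
  define A where "A = c0 + e * (of_real R * cis (s * y))"
  have p': "sin ((x - y) / 2) = - p"
    unfolding p_def sin_minus[symmetric] by (simp add: minus_divide_left)
  have 1: "c0 + e * (of_real R * cis (s * x)) - A = (- 2 * R * s * p) *\<^sub>R P"
    using arg_cong[OF chord[of x y], of "\<lambda>z. e * (of_real R * z)"]
    by (simp add: A_def P_def p' scaleR_conv_of_real algebra_simps)
  have 2: "c0 + e * (of_real R * cis (s * z)) - A = (2 * R * s * q) *\<^sub>R Q"
    using arg_cong[OF chord[of z y], of "\<lambda>z. e * (of_real R * z)"]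
    by (simp add: A_def Q_def q_def scaleR_conv_of_real algebra_simps)
  have "P \<bullet> Q = Re (cnj P * Q)"
    by (simp add: inner_complex_def)
  also have "cnj P * Q = (cnj e * e) * (cis (- (s * ((x + y) / 2))) * cis (s * ((z + y) / 2)))"
    by (simp add: P_def Q_def cis_cnj algebra_simps)
  also have "cnj e * e = 1"
    using complex_norm_square[of e] assms(2) by (simp add: mult.commute)
  also have "1 * (cis (- (s * ((x + y) / 2))) * cis (s * ((z + y) / 2))) = cis (s * ((z - x) / 2))"
    unfolding cis_mult mult_1 by (rule arg_cong[of _ _ cis]) (simp add: field_simps)
  also have "Re \<dots> = cos ((z - x) / 2)"
    using assms(3) cos_minus[of "(z - x) / 2"] by (auto simp: minus_divide_left simp del: cos_minus)
  finally have inner: "P \<bullet> Q = cos ((z - x) / 2)" .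
  have s2: "s * s = 1" "\<bar>s\<bar> = 1" using assms(3) by auto
  have "((- 2 * R * s * p) *\<^sub>R P) \<bullet> ((2 * R * s * q) *\<^sub>R Q) /
      (norm ((- 2 * R * s * p) *\<^sub>R P) * norm ((2 * R * s * q) *\<^sub>R Q)) =
      - (4 * R * R * (s * s) * p * q * cos ((z - x) / 2)) / (4 * R * R * p * q)"
    using assms(1) pq s2(2) by (simp add: inner PQ abs_mult)
  also have "\<dots> = - cos ((z - x) / 2)"
    using assms(1) pq by (simp add: s2(1))
  finally show ?thesis
    unfolding vertex_angle_def A_def[symmetric] 1 2 by (simp add: cos_arccos_abs)
qed

section \<open>Lifting polygons on the circle to increasing sequences of real angles\<close>

lemma lift_unit_circle:
  fixes z :: "nat \<Rightarrow> complex"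
  assumes norm: "\<And>i. cmod (z i) = 1" and Im: "\<And>i. sgn (Im (cnj (z i) * z (Suc i))) = s"
    and s: "s = 1 \<or> s = -1"
  obtains x :: "nat \<Rightarrow> real"
  where "\<And>i. z i = cis (s * x i)" and "\<And>i. 0 < x (Suc i) - x i \<and> x (Suc i) - x i < pi"
proof -
  \<comment> \<open>The orientation makes the imaginary part of each quotient nonzero, so these
    steps lie strictly between 0 and \<open>pi\<close>. Since \<open>s * s = 1\<close>, starting at
    \<open>s * Arg (z 0)\<close> makes \<open>cis (s * x i)\<close> correct in both
    orientations.\<close>
  define d where "d i = arccos (Re (cnj (z i) * z (Suc i)))" for i
  define x where "x i = s * Arg (z 0) + (\<Sum>j<i. d j)" for i
  have n: "cmod (cnj (z i) * z (Suc i)) = 1" for i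
    by (simp add: norm norm_mult)
  have Re: "\<bar>Re (cnj (z i) * z (Suc i))\<bar> < 1" for i
  proof -
    define w where "w = cnj (z i) * z (Suc i)"
    have "Im w \<noteq> 0" using Im[of i] s by (auto simp: w_def)
    then have "0 < (Im w)\<^sup>2" by simp
    moreover have "(Re w)\<^sup>2 + (Im w)\<^sup>2 = 1" using n[of i] cmod_power2[of w] by (simp only: w_def power_one)
    ultimately have "(Re w)\<^sup>2 < 1" by linarith
    then show ?thesis by (simp add: w_def abs_square_less_1)
  qed
  have d: "0 < d i" "d i < pi" for i
    using Re[of i] arccos_lt_bounded[of "Re (cnj (z i) * z (Suc i))"] by (auto simp: d_def abs_less_iff)
  have step: "cnj (z i) * z (Suc i) = cis (s * d i)" for i
  proof -
    define w where "w = cnj (z i) * z (Suc i)"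
    have w: "cos (d i) = Re w" using Re[of i] by (simp add: d_def w_def cos_arccos_abs)
    have "(Re w)\<^sup>2 + (Im w)\<^sup>2 = 1" using n[of i] cmod_power2[of w] by (simp only: w_def power_one)
    then have "(sin (d i))\<^sup>2 = (Im w)\<^sup>2" by (simp add: sin_squared_eq w)
    then have "\<bar>sin (d i)\<bar> = \<bar>Im w\<bar>" by (metis real_sqrt_abs)
    moreover have "sin (d i) > 0" using d[of i] by (intro sin_gt_zero)
    ultimately have "Im w = s * sin (d i)"
      using Im[of i, folded w_def] s by (auto simp: sgn_if split: if_splits)
    then show ?thesis using w s unfolding w_def[symmetric] by (auto simp: complex_eq_iff)
  qed
  have "z i = cis (s * x i)" for i
  proof (induction i)
    case 0
    have "z 0 = cis (Arg (z 0))"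
      using rcis_cmod_Arg[of "z 0"] norm[of 0] by (simp add: rcis_def)
    then show ?case using s by (auto simp: x_def)
  next
    case (Suc i)
    have "z (Suc i) = z i * (cnj (z i) * z (Suc i))"
      using complex_norm_square[of "z i"] norm[of i] by (simp only: mult.assoc[symmetric]) simp
    also have "\<dots> = cis (s * x i) * cis (s * d i)" unfolding step Suc.IH[symmetric] ..
    also have "\<dots> = cis (s * x (Suc i))"
      unfolding cis_mult x_def sum.lessThan_Suc distrib_left add.assoc ..
    finally show ?case .
  qed
  moreover have "0 < x (Suc i) - x i \<and> x (Suc i) - x i < pi" for i
    using d[of i] by (simp add: x_def)
  ultimately show thesis using that by blast
qed

text \<open>Clockwise polygons are lifted with negated angles. The chord equation contains only
  cosines, so both orientations lead to the same \<open>tangent_chord\<close> relation.\<close>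

lemma poncelet_polygon_lift:
  fixes R a b s :: real
  assumes "a > 0" and "b > 0" and "cmod e = 1" and "R > 0" and s: "s = 1 \<or> s = -1"
    and par: "poncelet_parameters ((a\<^sup>2 - b\<^sup>2) / R\<^sup>2) ((a\<^sup>2 + b\<^sup>2) / R\<^sup>2 - 1)"
    and poly: "poncelet_polygon c0 R (ellipse c0 a b e) n s u"
  obtains x :: "nat \<Rightarrow> real" and j :: int
  where "\<And>i. poncelet_parameters.tangent_chord ((a\<^sup>2 - b\<^sup>2) / R\<^sup>2) ((a\<^sup>2 + b\<^sup>2) / R\<^sup>2 - 1) (x i) (x (Suc i))"
    and "x n = x 0 + 2 * pi * of_int j"
    and "(\<Prod>i\<in>{1..n}. cos (vertex_angle (u (i - 1)) (u i) (u (i + 1)))) =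
      (\<Prod>i<n. - cos ((x (Suc (Suc i)) - x i) / 2))"
proof -
  have e: "e \<noteq> 0" using assms(3) by auto
  define z where "z i = (u i - c0) / (e * of_real R)" for i
  have uz: "u i - c0 = e * (of_real R * z i)" for i
    using e assms(4) by (simp add: z_def)
  have nz: "cmod (z i) = 1" for i
    using poly assms(3,4) by (simp add: z_def poncelet_polygon_def norm_divide norm_mult dist_norm)
  have ee: "cnj e * e = 1"
    using complex_norm_square[of e] assms(3) by (simp add: mult.commute)
  have "cnj (u i - c0) * (u (Suc i) - c0) = (cnj e * e) * of_real (R\<^sup>2) * (cnj (z i) * z (Suc i))" for i
    unfolding uz by (simp add: power2_eq_square)
  then have "sgn (Im (cnj (u i - c0) * (u (Suc i) - c0))) = sgn (Im (cnj (z i) * z (Suc i)))" for i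
    using assms(4) by (simp add: ee sgn_mult del: of_real_power)
  then have sz: "sgn (Im (cnj (z i) * z (Suc i))) = s" for i
    using poly by (simp add: poncelet_polygon_def)
  obtain x where zx: "\<And>i. z i = cis (s * x i)"
    and x: "\<And>i. 0 < x (Suc i) - x i \<and> x (Suc i) - x i < pi"
    using lift_unit_circle[of z, OF nz sz s] by blast
  have u: "u i = c0 + e * (of_real R * cis (s * x i))" for i
    using uz[of i] by (simp add: zx algebra_simps)
  have "poncelet_parameters.tangent_chord ((a\<^sup>2 - b\<^sup>2) / R\<^sup>2) ((a\<^sup>2 + b\<^sup>2) / R\<^sup>2 - 1) (x i) (x (Suc i))" for i
  proof -
    have sin: "sin (x (Suc i) - x i) > 0"
      using x[of i] by (intro sin_gt_zero) auto
    have d: "s * x (Suc i) - s * x i = s * (x (Suc i) - x i)" "s * x i + s * x (Suc i) = s * (x i + x (Suc i))"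
      by (simp_all add: algebra_simps)
    have c: "cos (s * t) = cos t" "sin (s * t) = s * sin t" for t using s by auto
    have "tangent_line (ellipse c0 a b e) (u i) (u (Suc i))"
      using poly by (simp add: poncelet_polygon_def)
    moreover have "sin (s * x (Suc i) - s * x i) \<noteq> 0"
      unfolding d c using sin s by auto
    ultimately show ?thesis
      using tangent_chord_angles[OF assms(1,2) e assms(4)] x[of i]
      unfolding poncelet_parameters.tangent_chord_def[OF par] u by (metis d c(1))
  qed
  moreover obtain j where "x n = x 0 + 2 * pi * of_int j"
  proof -
    have "u n = u 0" using poly by (metis poncelet_polygon_def add_0)
    then have "cis (s * x n) = cis (s * x 0)"
      using e assms(4) by (simp add: u)
    then have "sin (x n) = sin (x 0) \<and> cos (x n) = cos (x 0)"
      using s by (auto simp: complex_eq_iff)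
    then obtain j where "x n = x 0 + 2 * pi * of_int j"
      using sin_cos_eq_iff by blast
    then show thesis by (rule that)
  qed
  moreover have "(\<Prod>i\<in>{1..n}. cos (vertex_angle (u (i - 1)) (u i) (u (i + 1)))) =
      (\<Prod>i<n. - cos ((x (Suc (Suc i)) - x i) / 2))"
  proof -
    have b: "0 < x (Suc i) - x i" "x (Suc i) - x i < 2 * pi" for i
      using x[of i] pi_gt_zero by linarith+
    \<comment> \<open>Reindexing from \<open>1..n\<close> puts the apex at \<open>Suc i\<close>, so
      the subtraction of 1 is never truncated.\<close>
    have "cos (vertex_angle (u (Suc i - 1)) (u (Suc i)) (u (Suc i + 1))) =
        - cos ((x (Suc (Suc i)) - x i) / 2)" for i
      using cos_vertex_angle_circle[OF assms(4,3) s b[of i] b[of "Suc i"], of c0]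
      unfolding diff_Suc_1 Suc_eq_plus1[symmetric] u[symmetric] .
    then show ?thesis
      by (simp add: prod.atLeast1_atMost_eq)
  qed
  ultimately show thesis by (rule that[of x j])
qed

section \<open>Reduction of the geometric statement to angles\<close>

theorem theorem5p1:
  fixes c0 e :: complex and R a b s :: real and n :: nat and u v :: "nat \<Rightarrow> complex"
  assumes "n \<ge> 3"
    and "a > 0" and "b > 0" and "cmod e = 1"
    and "ellipse c0 a b e \<subseteq> ball c0 R"
    and "s = 1 \<or> s = -1"
    and "poncelet_polygon c0 R (ellipse c0 a b e) n s u"
    and "poncelet_polygon c0 R (ellipse c0 a b e) n s v"
  shows "(\<Prod>i\<in>{1..n}. cos (vertex_angle (u (i - 1)) (u i) (u (i + 1))))
       = (\<Prod>i\<in>{1..n}. cos (vertex_angle (v (i - 1)) (v i) (v (i + 1))))"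
proof -
  have "c0 + e * Complex (a * cos t) (b * sin t) \<in> ball c0 R" for t
    using assms(5) by (auto simp: ellipse_def)
  then have "cmod (e * Complex (a * cos t) (b * sin t)) < R" for t
    by (simp only: mem_ball dist_norm) (metis add_diff_cancel_left' norm_minus_commute)
  \<comment> \<open>The endpoints of the two axes lie inside the circle, which bounds both semi-axes
    by \<open>R\<close>.\<close>
  from this[of 0] this[of "pi / 2"] have "cmod (e * Complex a 0) < R" "cmod (e * Complex 0 b) < R"
    by simp_all
  then have ab: "a < R" "b < R"
    using assms(2-4) unfolding norm_mult by (simp_all add: cmod_def)
  then have R: "R > 0" using assms(2) by linarith
  define \<alpha> \<beta> where "\<alpha> = a\<^sup>2 / R\<^sup>2" and "\<beta> = b\<^sup>2 / R\<^sup>2"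
  have "0 < \<alpha>" "0 < \<beta>" using assms(2,3) R by (simp_all add: \<alpha>_def \<beta>_def)
  moreover have "\<alpha> < 1" "\<beta> < 1"
    using ab assms(2,3) R by (simp_all add: \<alpha>_def \<beta>_def power_strict_mono)
  \<comment> \<open>The left side is the larger of \<open>\<bar>2 * \<alpha> - 1\<bar>\<close> and
    \<open>\<bar>2 * \<beta> - 1\<bar>\<close>.\<close>
  ultimately have "\<bar>\<alpha> - \<beta>\<bar> + \<bar>\<alpha> + \<beta> - 1\<bar> < 1" by arith
  then have par: "poncelet_parameters ((a\<^sup>2 - b\<^sup>2) / R\<^sup>2) ((a\<^sup>2 + b\<^sup>2) / R\<^sup>2 - 1)"
    by (unfold_locales) (simp add: \<alpha>_def \<beta>_def diff_divide_distrib add_divide_distrib)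
  note lift = poncelet_polygon_lift[OF assms(2-4) R assms(6) par]
  obtain x j where x: "\<And>i. poncelet_parameters.tangent_chord ((a\<^sup>2 - b\<^sup>2) / R\<^sup>2) ((a\<^sup>2 + b\<^sup>2) / R\<^sup>2 - 1) (x i) (x (Suc i))"
    "x n = x 0 + 2 * pi * of_int j"
    "(\<Prod>i\<in>{1..n}. cos (vertex_angle (u (i - 1)) (u i) (u (i + 1)))) = (\<Prod>i<n. - cos ((x (Suc (Suc i)) - x i) / 2))"
    using lift[OF assms(7)] by blast
  obtain y where y: "\<And>i. poncelet_parameters.tangent_chord ((a\<^sup>2 - b\<^sup>2) / R\<^sup>2) ((a\<^sup>2 + b\<^sup>2) / R\<^sup>2 - 1) (y i) (y (Suc i))"
    "(\<Prod>i\<in>{1..n}. cos (vertex_angle (v (i - 1)) (v i) (v (i + 1)))) = (\<Prod>i<n. - cos ((y (Suc (Suc i)) - y i) / 2))"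
    using lift[OF assms(8)] by blast
  have "(\<Prod>i<n. - f i) = (- 1) ^ n * (\<Prod>i<n. f i)" for f :: "nat \<Rightarrow> real"
    by (induction n) auto
  then show ?thesis
    unfolding x(3) y(2) using poncelet_parameters.prod_cos_half_vertex_const[of _ _ x y, OF par x(1) y(1) x(2)]
    by metis
qed

end
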